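(* Let $r\ge 0$ be an integer. The error propagator of two-level MGRIT with $r$FCF-relaxation, i.e. the operator $\mathcal{E}_{rFCF}^{n_\ell=2}=(I-P_0A_1^{-1}R_0A_0)\,(F_0C_0)^rF_0$ obtained by applying $r$FCF-relaxation on level $0$ followed by the coarse-grid correction in which the exact coarse-grid operator $R_0A_0P_0$ is replaced by $A_1$, is given by $$\mathcal{E}_{rFCF}^{n_\ell=2}=(I-P_0A_1^{-1}R_0A_0)\,P_0\,(I-R_0A_0P_0)^r\,R_{I_0}.$$
   Context: Fix $N_x\ge1$, a coarsening factor $m_0\ge1$, and $N_0$ such that $N_1=(N_0-1)/m_0+1$ is an integer $\ge 2$. Let $\Phi_0,\Phi_1\in\mathbb{R}^{N_x\times N_x}$ (time-stepping operators on the fine level $0$ and coarse level $1$). Vectors on level $\ell$ consist of $N_\ell$ blocks of size $N_x$, indexed $0,\dots,N_\ell-1$; $I$ denotes an identity of appropriate size. - $A_\ell\in\mathbb{R}^{N_xN_\ell\times N_xN_\ell}$ ($\ell=0,1$) is block lower bidiagonal with $I$ on the block diagonal and $-\Phi_\ell$ on the first block subdiagonal. - On level $0$, block indices that are multiples of $m_0$ are C-points (there are $N_1$ of them); the others are F-points. - Ideal restriction $R_0$ ($N_1\times N_0$ blocks): block row $0$ has $I$ in block column $0$; block row $j\ge1$ has $\Phi_0^{m_0-i}$ in block column $(j-1)m_0+i$ for $i=1,\dots,m_0$; all other blocks are zero. - Ideal interpolation $P_0$ ($N_0\times N_1$ blocks): block column $j$ has $\Phi_0^{i}$ in block row $jm_0+i$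 for $0\le i\le m_0-1$ with $jm_0+i\le N_0-1$; all other blocks are zero. - $R_{I_0}$ ($N_1\times N_0$ blocks), restriction by injection: block row $j$ has $I$ in block column $jm_0$, zeros elsewhere. $T_0=R_{I_0}^T$. - $S_0$: the block columns of the identity on level $0$ that correspond to F-points (injection of F-points). - F-relaxation has error propagator $F_0=I-S_0(S_0^TA_0S_0)^{-1}S_0^TA_0$ (which equals $P_0R_{I_0}$; $F_0=I$ if there are no F-points). - C-relaxation (update each C-point by one time step from the preceding point, i.e. block Jacobi applied to the C-point block rows of $A_0$) has error propagator $C_0=I-T_0T_0^TA_0$; for $m_0\ge2$ this equals $I-T_0(T_0^TA_0T_0)^{-1}T_0^TA_0$ because then $T_0^TA_0T_0=I$. - $r$FCF-relaxation is one F-relaxation followed by $r$ CF-relaxation steps (each a C-relaxation followed by an F-relaxation), with error propagator $(F_0C_0)^rF_0$. *)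

theory Defs
  imports "Jordan_Normal_Form.Gauss_Jordan_Elimination"
begin

(* The nr x nc block matrix whose blocks B i j are n x n; entry (i, j) of the assembled
   matrix lies in block (i div n, j div n). *)
definition blocks_mat :: "nat \<Rightarrow> nat \<Rightarrow> nat \<Rightarrow> (nat \<Rightarrow> nat \<Rightarrow> real mat) \<Rightarrow> real mat" where
  "blocks_mat n nr nc B =
     mat (nr * n) (nc * n) (\<lambda>(i, j). B (i div n) (j div n) $$ (i mod n, j mod n))"

(* mat_inverse returns None on a singular matrix, so this is only meaningful for invertible
   arguments. It is applied below to A_1 and to S^T A_0 S, which are both lower triangular
   with unit diagonal (and to the 0 x 0 matrix if there are no F-points). *)
definition inv_mat :: "real mat \<Rightarrow> real mat" where
  "inv_mat A = the (mat_inverse A)"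

definition time_mat :: "nat \<Rightarrow> nat \<Rightarrow> real mat \<Rightarrow> real mat" where
  "time_mat n N \<Phi> = blocks_mat n N N (\<lambda>i j.
     if i = j then 1\<^sub>m n else if i = j + 1 then - \<Phi> else 0\<^sub>m n n)"

(* Block column k carries Phi^(m - i) in block row j >= 1, where k = (j - 1) * m + i
   with 1 <= i <= m. *)
definition ideal_restriction :: "nat \<Rightarrow> nat \<Rightarrow> nat \<Rightarrow> nat \<Rightarrow> real mat \<Rightarrow> real mat" where
  "ideal_restriction n m N0 N1 \<Phi> = blocks_mat n N1 N0 (\<lambda>j k.
     if j = 0 then (if k = 0 then 1\<^sub>m n else 0\<^sub>m n n)
     else if (j - 1) * m + 1 \<le> k \<and> k \<le> (j - 1) * m + m
       then \<Phi> ^\<^sub>m (m - (k - (j - 1) * m))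
     else 0\<^sub>m n n)"

(* Block row k carries Phi^i in block column j, where k = j * m + i with 0 <= i <= m - 1. *)
definition ideal_interpolation :: "nat \<Rightarrow> nat \<Rightarrow> nat \<Rightarrow> nat \<Rightarrow> real mat \<Rightarrow> real mat" where
  "ideal_interpolation n m N0 N1 \<Phi> = blocks_mat n N0 N1 (\<lambda>k j.
     if j * m \<le> k \<and> k < j * m + m then \<Phi> ^\<^sub>m (k - j * m) else 0\<^sub>m n n)"

definition injection_restriction :: "nat \<Rightarrow> nat \<Rightarrow> nat \<Rightarrow> nat \<Rightarrow> real mat" where
  "injection_restriction n m N0 N1 = blocks_mat n N1 N0 (\<lambda>j k.
     if k = j * m then 1\<^sub>m n else 0\<^sub>m n n)"

definition F_points :: "nat \<Rightarrow> nat \<Rightarrow> nat list" where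
  "F_points m N0 = filter (\<lambda>k. \<not> m dvd k) [0..<N0]"

definition F_injection :: "nat \<Rightarrow> nat \<Rightarrow> nat \<Rightarrow> real mat" where
  "F_injection n m N0 = blocks_mat n N0 (length (F_points m N0)) (\<lambda>k q.
     if k = F_points m N0 ! q then 1\<^sub>m n else 0\<^sub>m n n)"

definition F_relax :: "nat \<Rightarrow> nat \<Rightarrow> nat \<Rightarrow> real mat \<Rightarrow> real mat" where
  "F_relax n m N0 \<Phi> =
     (let A = time_mat n N0 \<Phi>; S = F_injection n m N0
      in 1\<^sub>m (N0 * n) - S * inv_mat (transpose_mat S * A * S) * transpose_mat S * A)"

definition C_relax :: "nat \<Rightarrow> nat \<Rightarrow> nat \<Rightarrow> nat \<Rightarrow> real mat \<Rightarrow> real mat" where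
  "C_relax n m N0 N1 \<Phi> =
     (let A = time_mat n N0 \<Phi>; T = transpose_mat (injection_restriction n m N0 N1)
      in 1\<^sub>m (N0 * n) - T * transpose_mat T * A)"

definition rFCF_relax :: "nat \<Rightarrow> nat \<Rightarrow> nat \<Rightarrow> nat \<Rightarrow> nat \<Rightarrow> real mat \<Rightarrow> real mat" where
  "rFCF_relax r n m N0 N1 \<Phi> =
     (F_relax n m N0 \<Phi> * C_relax n m N0 N1 \<Phi>) ^\<^sub>m r * F_relax n m N0 \<Phi>"

definition coarse_correction ::
    "nat \<Rightarrow> nat \<Rightarrow> nat \<Rightarrow> nat \<Rightarrow> real mat \<Rightarrow> real mat \<Rightarrow> real mat" where
  "coarse_correction n m N0 N1 \<Phi>0 \<Phi>1 =
     1\<^sub>m (N0 * n) - ideal_interpolation n m N0 N1 \<Phi>0 * inv_mat (time_mat n N1 \<Phi>1) *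
       ideal_restriction n m N0 N1 \<Phi>0 * time_mat n N0 \<Phi>0"

definition mgrit_error ::
    "nat \<Rightarrow> nat \<Rightarrow> nat \<Rightarrow> nat \<Rightarrow> nat \<Rightarrow> real mat \<Rightarrow> real mat \<Rightarrow> real mat" where
  "mgrit_error r n m N0 N1 \<Phi>0 \<Phi>1 =
     coarse_correction n m N0 N1 \<Phi>0 \<Phi>1 * rFCF_relax r n m N0 N1 \<Phi>0"

end

theory Submission
  imports Defs "Jordan_Normal_Form.Determinant"
begin

text \<open>Write \<open>A\<close>, \<open>P\<close>, \<open>R\<close>, \<open>S\<close>, \<open>T\<close> for the level-0 operators and \<open>J = T\<^sup>T\<close> for injection.
  Everything follows from four relations: \<open>J P = I\<close>, \<open>R T = I\<close>, \<open>S\<^sup>T A P = 0\<close> (the columns of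
  \<open>P\<close> are propagated exactly through the F-points) and \<open>S S\<^sup>T + T J = I\<close>.
  The last two give \<open>A P = T J A P\<close>, hence \<open>R A P = J A P\<close>.
  Since \<open>F S = 0\<close> and \<open>F P = P\<close>, also \<open>F = F T J\<close> and \<open>P = F T J P = F T\<close>, so \<open>F = P J\<close>.
  Then \<open>F C P = P J (P - T J A P) = P J (P - A P) = P (I - R A P)\<close>, and this intertwining
  passes to powers.\<close>

section \<open>Powers under an intertwining relation; inverses from the determinant\<close>

lemma pow_mat_intertwine:
  assumes M: "M \<in> carrier_mat a a" and P: "P \<in> carrier_mat a b" and D: "D \<in> carrier_mat b b"
    and MP: "M * P = P * D"
  shows "M ^\<^sub>m r * P = P * D ^\<^sub>m r"
proof (induction r)
  case 0
  then show ?case using M P D by simp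
next
  case (Suc r)
  have "M ^\<^sub>m Suc r * P = M ^\<^sub>m r * (M * P)"
    using M P by (simp add: assoc_mult_mat[of _ a a _ a _ b])
  also have "\<dots> = (M ^\<^sub>m r * P) * D"
    using M P D by (simp add: MP assoc_mult_mat[of _ a a _ b _ b])
  also have "\<dots> = P * D ^\<^sub>m Suc r"
    using M P D by (simp add: Suc assoc_mult_mat[of _ a b _ b _ b])
  finally show ?case .
qed

text \<open>A non-zero determinant makes the matrix a unit, so \<open>mat_inverse\<close> returns
  \<open>Some\<close> and the \<open>the\<close> in \<open>inv_mat\<close> is meaningful.\<close>

lemma inv_mat_left_inverse:
  assumes A: "A \<in> carrier_mat n n" and "det A \<noteq> 0"
  shows "inv_mat A \<in> carrier_mat n n" and "inv_mat A * A = 1\<^sub>m n"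
proof -
  obtain B where B: "mat_inverse A = Some B"
    \<comment> \<open>The dummy parameter \<open>b\<close> of the matrix ring is fixed so that both
      facts speak of the same ring.\<close>
    using det_non_zero_imp_unit[OF assms, where b = "()"] mat_inverse(1)[OF A, where b = "()"]
    by (cases "mat_inverse A") auto
  show "inv_mat A \<in> carrier_mat n n" and "inv_mat A * A = 1\<^sub>m n"
    using mat_inverse(2)[OF A B] by (simp_all add: inv_mat_def B)
qed

section \<open>Block matrices\<close>

lemma blocks_mat_carrier [simp]: "blocks_mat n a b B \<in> carrier_mat (a * n) (b * n)"
  by (simp add: blocks_mat_def)

lemma blocks_mat_dim [simp]:
  "dim_row (blocks_mat n a b B) = a * n" "dim_col (blocks_mat n a b B) = b * n"
  by (simp_all add: blocks_mat_def)

lemma div_mod_less_mult: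
  fixes i :: nat
  assumes "i < a * n"
  shows "i div n < a" and "i mod n < n"
  \<comment> \<open>For \<open>n = 0\<close> no \<open>i < a * n\<close> exists; otherwise the
    remainder is below \<open>n\<close>.\<close>
  using assms by (simp_all add: less_mult_imp_div_less, cases n, auto)

lemma blocks_mat_index:
  "i < a * n \<Longrightarrow> j < b * n \<Longrightarrow>
    blocks_mat n a b B $$ (i, j) = B (i div n) (j div n) $$ (i mod n, j mod n)"
  by (simp add: blocks_mat_def)

lemma blocks_mat_cong:
  assumes "\<And>I J. I < a \<Longrightarrow> J < b \<Longrightarrow> B I J = C I J"
  shows "blocks_mat n a b B = blocks_mat n a b C"
  by (rule eq_matI) (simp_all add: blocks_mat_index assms div_mod_less_mult)

lemma blocks_mat_one: "blocks_mat n a a (\<lambda>i j. if i = j then 1\<^sub>m n else 0\<^sub>m n n) = 1\<^sub>m (a * n)"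
proof (rule eq_matI)
  fix i j assume ij: "i < dim_row (1\<^sub>m (a * n) :: real mat)" "j < dim_col (1\<^sub>m (a * n) :: real mat)"
  have "i = j \<longleftrightarrow> i div n = j div n \<and> i mod n = j mod n"
    by (metis div_mult_mod_eq)
  then show "blocks_mat n a a (\<lambda>i j. if i = j then 1\<^sub>m n else 0\<^sub>m n n) $$ (i, j) = 1\<^sub>m (a * n) $$ (i, j)"
    using ij by (auto simp: blocks_mat_index div_mod_less_mult)
qed simp_all

lemma transpose_blocks_mat:
  assumes "\<And>I J. B I J \<in> carrier_mat n n"
  shows "transpose_mat (blocks_mat n a b B) = blocks_mat n b a (\<lambda>i j. transpose_mat (B j i))"
proof (rule eq_matI)
  fix i j assume "i < dim_row (blocks_mat n b a (\<lambda>i j. transpose_mat (B j i)))"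
    and "j < dim_col (blocks_mat n b a (\<lambda>i j. transpose_mat (B j i)))"
  then show "transpose_mat (blocks_mat n a b B) $$ (i, j) =
      blocks_mat n b a (\<lambda>i j. transpose_mat (B j i)) $$ (i, j)"
    using carrier_matD[OF assms] by (simp add: blocks_mat_index div_mod_less_mult)
qed simp_all

text \<open>The inner index range of length \<open>b * n\<close> splits into \<open>b\<close> runs
  of length \<open>n\<close>, and each run is the scalar product inside one product of blocks. The
  sum is over entries, since matrices of varying dimension have no common zero to sum from.\<close>

lemma blocks_mat_mult_index:
  assumes A: "\<And>I J. A I J \<in> carrier_mat n n" and B: "\<And>I J. B I J \<in> carrier_mat n n"
    and i: "i < a * n" and j: "j < c * n"
  shows "(blocks_mat n a b A * blocks_mat n b c B) $$ (i, j) =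
    (\<Sum>K<b. (A (i div n) K * B K (j div n)) $$ (i mod n, j mod n))"
proof -
  let ?f = "\<lambda>k. A (i div n) (k div n) $$ (i mod n, k mod n) * B (k div n) (j div n) $$ (k mod n, j mod n)"
  have "(blocks_mat n a b A * blocks_mat n b c B) $$ (i, j) = sum ?f {..<b * n}"
    using i j by (simp add: times_mat_def scalar_prod_def blocks_mat_index atLeast0LessThan)
  also have "\<dots> = (\<Sum>K<b. sum ?f {K * n..<K * n + n})"
    by (simp add: sum.nat_group)
  also have "\<dots> = (\<Sum>K<b. (A (i div n) K * B K (j div n)) $$ (i mod n, j mod n))"
  proof (rule sum.cong[OF refl])
    fix K
    have "sum ?f {K * n..<K * n + n} = (\<Sum>l<n. ?f (l + K * n))"
      using sum.shift_bounds_nat_ivl[of ?f 0 "K * n" n]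
      by (simp add: atLeast0LessThan add.commute)
    also have "\<dots> = (\<Sum>l<n. A (i div n) K $$ (i mod n, l) * B K (j div n) $$ (l, j mod n))"
      by (rule sum.cong) auto
    also have "\<dots> = (A (i div n) K * B K (j div n)) $$ (i mod n, j mod n)"
      using carrier_matD[OF A] carrier_matD[OF B] div_mod_less_mult[OF i] div_mod_less_mult[OF j]
      by (simp add: times_mat_def scalar_prod_def atLeast0LessThan)
    finally show "sum ?f {K * n..<K * n + n} =
      (A (i div n) K * B K (j div n)) $$ (i mod n, j mod n)" .
  qed
  finally show ?thesis .
qed

lemma blocks_mat_mult_eqI:
  assumes "\<And>I J. A I J \<in> carrier_mat n n" and "\<And>I J. B I J \<in> carrier_mat n n"
    and "\<And>I J p q. I < a \<Longrightarrow> J < c \<Longrightarrow> p < n \<Longrightarrow> q < n \<Longrightarrow>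
      (\<Sum>K<b. (A I K * B K J) $$ (p, q)) = C I J $$ (p, q)"
  shows "blocks_mat n a b A * blocks_mat n b c B = blocks_mat n a c C"
proof (rule eq_matI)
  fix i j assume "i < dim_row (blocks_mat n a c C)" and "j < dim_col (blocks_mat n a c C)"
  then have ij: "i < a * n" "j < c * n" by simp_all
  show "(blocks_mat n a b A * blocks_mat n b c B) $$ (i, j) = blocks_mat n a c C $$ (i, j)"
    unfolding blocks_mat_mult_index[OF assms(1,2) ij] blocks_mat_index[OF ij]
    using div_mod_less_mult[OF ij(1)] div_mod_less_mult[OF ij(2)] by (intro assms(3))
qed simp_all

section \<open>Selection of block columns\<close>

text \<open>The common form of both injections: \<open>s j = j * m\<close> gives \<open>T\<close>,
  and an enumeration of the F-points gives \<open>S\<close>.\<close>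

definition selection_mat :: "nat \<Rightarrow> nat \<Rightarrow> nat \<Rightarrow> (nat \<Rightarrow> nat) \<Rightarrow> real mat" where
  "selection_mat n a b s = blocks_mat n a b (\<lambda>i j. if i = s j then 1\<^sub>m n else 0\<^sub>m n n)"

lemma selection_mat_carrier [simp]: "selection_mat n a b s \<in> carrier_mat (a * n) (b * n)"
  by (simp add: selection_mat_def)

lemma transpose_selection_mat:
  "transpose_mat (selection_mat n a b s) = blocks_mat n b a (\<lambda>j i. if i = s j then 1\<^sub>m n else 0\<^sub>m n n)"
  unfolding selection_mat_def
  by (subst transpose_blocks_mat) (auto intro!: blocks_mat_cong)

text \<open>Only the summand \<open>K = s I\<close> survives, and \<open>s j < a\<close> keeps it in
  range.\<close>

lemma transpose_selection_mult:
  assumes B: "\<And>I J. B I J \<in> carrier_mat n n" and s: "\<And>j. j < b \<Longrightarrow> s j < a"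
  shows "transpose_mat (selection_mat n a b s) * blocks_mat n a c B = blocks_mat n b c (\<lambda>i j. B (s i) j)"
  unfolding transpose_selection_mat
proof (rule blocks_mat_mult_eqI)
  fix I J p q assume *: "I < b" "J < c" "p < n" "q < n"
  have "((if K = s I then 1\<^sub>m n else 0\<^sub>m n n) * B K J) $$ (p, q) =
      (if K = s I then B K J $$ (p, q) else 0)" for K
    using * by (simp add: left_mult_zero_mat[OF B] left_mult_one_mat[OF B] del: index_mult_mat(1))
  then show "(\<Sum>K<a. ((if K = s I then 1\<^sub>m n else 0\<^sub>m n n) * B K J) $$ (p, q)) = B (s I) J $$ (p, q)"
    using s * by simp
qed (use B in auto)

lemma mult_selection:
  assumes B: "\<And>I J. B I J \<in> carrier_mat n n" and s: "\<And>j. j < b \<Longrightarrow> s j < a"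
  shows "blocks_mat n c a B * selection_mat n a b s = blocks_mat n c b (\<lambda>i j. B i (s j))"
  unfolding selection_mat_def
proof (rule blocks_mat_mult_eqI)
  fix I J p q assume *: "I < c" "J < b" "p < n" "q < n"
  have "(B I K * (if K = s J then 1\<^sub>m n else 0\<^sub>m n n)) $$ (p, q) =
      (if K = s J then B I K $$ (p, q) else 0)" for K
    using * by (simp add: right_mult_zero_mat[OF B] right_mult_one_mat[OF B] del: index_mult_mat(1))
  then show "(\<Sum>K<a. (B I K * (if K = s J then 1\<^sub>m n else 0\<^sub>m n n)) $$ (p, q)) = B I (s J) $$ (p, q)"
    using s * by simp
qed (use B in auto)

text \<open>This is the projector onto the selected blocks. Injectivity keeps any block from being
  counted twice.\<close>

lemma selection_mult_transpose:
  assumes s: "inj_on s {..<b}"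
  shows "selection_mat n a b s * transpose_mat (selection_mat n a b s) =
    blocks_mat n a a (\<lambda>i j. if i = j \<and> i \<in> s ` {..<b} then 1\<^sub>m n else 0\<^sub>m n n)"
  unfolding transpose_selection_mat unfolding selection_mat_def
proof (rule blocks_mat_mult_eqI)
  fix I J p q assume *: "I < a" "J < a" "p < n" "q < n"
  have eq: "((if I = s K then 1\<^sub>m n else 0\<^sub>m n n) * (if J = s K then 1\<^sub>m n else 0\<^sub>m n n)) $$ (p, q) =
      (if I = s K \<and> J = s K \<and> p = q then 1 else 0 :: real)" for K
    using * by simp
  have "(\<Sum>K<b. if I = s K \<and> J = s K \<and> p = q then 1 else 0 :: real) =
      (if I = J \<and> p = q \<and> I \<in> s ` {..<b} then 1 else 0)"
  proof (cases "I = J \<and> p = q \<and> I \<in> s ` {..<b}")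
    case True
    \<comment> \<open>By injectivity \<open>L\<close> is the only preimage of \<open>I\<close>, so
      exactly one summand is non-zero.\<close>
    then obtain L where L: "L < b" "I = s L" by auto
    have "(\<Sum>K<b. if I = s K \<and> J = s K \<and> p = q then 1 else 0 :: real) =
        (\<Sum>K<b. if K = L then 1 else 0)"
      using True L s by (intro sum.cong) (auto dest: inj_onD)
    then show ?thesis using True L(1) by auto
  next
    case False
    then show ?thesis by (auto intro!: sum.neutral)
  qed
  then show "(\<Sum>K<b. ((if I = s K then 1\<^sub>m n else 0\<^sub>m n n) * (if J = s K then 1\<^sub>m n else 0\<^sub>m n n)) $$ (p, q)) =
      (if I = J \<and> I \<in> s ` {..<b} then 1\<^sub>m n else 0\<^sub>m n n :: real mat) $$ (p, q)"
    using * unfolding eq by auto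
qed auto

text \<open>Every block index is selected by exactly one of \<open>s\<close> and \<open>t\<close>,
  so the two projectors add up to the identity. Used with the F-points and the C-points.\<close>

lemma selection_complement:
  assumes "inj_on s {..<b}" and "inj_on t {..<c}"
    and "s ` {..<b} \<inter> t ` {..<c} = {}" and "{..<a} \<subseteq> s ` {..<b} \<union> t ` {..<c}"
  shows "selection_mat n a b s * transpose_mat (selection_mat n a b s) +
    selection_mat n a c t * transpose_mat (selection_mat n a c t) = 1\<^sub>m (a * n)" (is "?L = _")
proof -
  have "?L = blocks_mat n a a (\<lambda>i j. if i = j then 1\<^sub>m n else 0\<^sub>m n n)"
  proof (rule eq_matI)
    fix i j
    assume "i < dim_row (blocks_mat n a a (\<lambda>i j. if i = j then 1\<^sub>m n else 0\<^sub>m n n))"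
      and "j < dim_col (blocks_mat n a a (\<lambda>i j. if i = j then 1\<^sub>m n else 0\<^sub>m n n))"
    then have ij: "i < a * n" "j < a * n" by simp_all
    then consider "i div n \<in> s ` {..<b}" "i div n \<notin> t ` {..<c}"
      | "i div n \<notin> s ` {..<b}" "i div n \<in> t ` {..<c}"
      using assms(3,4) div_mod_less_mult[OF ij(1)] by blast
    then show "?L $$ (i, j) =
        blocks_mat n a a (\<lambda>i j. if i = j then 1\<^sub>m n else 0\<^sub>m n n) $$ (i, j)"
      unfolding selection_mult_transpose[OF assms(1)] selection_mult_transpose[OF assms(2)]
      using ij div_mod_less_mult[OF ij(1)] div_mod_less_mult[OF ij(2)]
      by cases (simp_all add: blocks_mat_index del: image_iff)
  qed (simp_all add: selection_mult_transpose assms(1,2))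
  then show ?thesis by (simp add: blocks_mat_one)
qed

section \<open>The level-0 operators\<close>

lemma time_mat_carrier [simp]: "time_mat n N \<Phi> \<in> carrier_mat (N * n) (N * n)"
  by (simp add: time_mat_def)

text \<open>For \<open>s\<close> enumerating the F-points this matrix is \<open>S^T A S\<close>. As
  \<open>s\<close> is increasing, a block above the diagonal has \<open>s i < s j\<close> and
  vanishes, while diagonal blocks are identities: the matrix is unit lower triangular. The case
  \<open>b = 0\<close> of no F-points is included.\<close>

lemma det_principal_time_mat:
  fixes s :: "nat \<Rightarrow> nat"
  assumes s: "strict_mono_on {..<b} s"
    and \<Phi>: "\<Phi> \<in> carrier_mat n n"
  shows "det (blocks_mat n b b (\<lambda>i j. if s i = s j then 1\<^sub>m n
      else if s i = s j + 1 then - \<Phi> else 0\<^sub>m n n)) = 1" (is "det ?X = 1")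
proof -
  have "?X $$ (i, j) = 0" if ij: "i < j" "j < b * n" for i j
  proof -
    have i: "i < b * n" using ij by simp
    note dm = div_mod_less_mult[OF i] div_mod_less_mult[OF ij(2)]
    have le: "i div n \<le> j div n" using ij by (simp add: div_le_mono)
    show ?thesis
    proof (cases "i div n = j div n")
      case True
      then have "i mod n \<noteq> j mod n" using ij by (metis div_mult_mod_eq less_irrefl)
      then show ?thesis using True i ij dm by (simp add: blocks_mat_index)
    next
      case False
      then have "s (i div n) < s (j div n)"
        using le dm s by (auto intro: strict_mono_onD)
      then show ?thesis using i ij dm by (simp add: blocks_mat_index)
    qed
  qed
  then have "det ?X = prod_list (diag_mat ?X)"
    by (intro det_lower_triangular[of "b * n"]) auto
  also have "diag_mat ?X = map (\<lambda>_. 1) [0..<b * n]"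
    by (auto simp: diag_mat_def blocks_mat_index div_mod_less_mult)
  also have "prod_list \<dots> = (1 :: real)"
    by (simp add: map_replicate_const)
  finally show ?thesis .
qed

text \<open>If \<open>Suc k\<close> is an F-point, then \<open>k\<close> and \<open>Suc k\<close>
  lie in the same coarse interval, where one step down a column of \<open>P\<close> is one
  application of \<open>\<Phi>\<close>.\<close>

lemma interpolation_block_step:
  assumes "\<Phi> \<in> carrier_mat n n" and "\<not> m dvd Suc k"
  shows "(if j * m \<le> Suc k \<and> Suc k < j * m + m then \<Phi> ^\<^sub>m (Suc k - j * m) else 0\<^sub>m n n) =
    \<Phi> * (if j * m \<le> k \<and> k < j * m + m then \<Phi> ^\<^sub>m (k - j * m) else 0\<^sub>m n n)"
proof -
  have ne: "Suc k \<noteq> j * m" "Suc k \<noteq> j * m + m"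
    using assms(2) by (auto simp flip: mult_Suc)
  then have iff: "j * m \<le> Suc k \<and> Suc k < j * m + m \<longleftrightarrow> j * m \<le> k \<and> k < j * m + m"
    by linarith
  \<comment> \<open>A power unfolds with its extra factor on the right; intertwining
    \<open>\<Phi>\<close> with itself moves that factor to the left.\<close>
  have "\<Phi> ^\<^sub>m (Suc k - j * m) = \<Phi> * \<Phi> ^\<^sub>m (k - j * m)" if "j * m \<le> k"
    using that pow_mat_intertwine[OF assms(1) assms(1) assms(1) refl] by (simp add: Suc_diff_le)
  then show ?thesis
    using assms(1) unfolding iff by auto
qed

text \<open>Row \<open>Suc k\<close> has two non-zero blocks, at \<open>Suc k\<close> and at
  \<open>k\<close>, so the product is the residual of one time step.\<close>

lemma time_mat_block_row_mult:
  fixes \<Phi> :: "real mat"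
  assumes \<Phi>: "\<Phi> \<in> carrier_mat n n" and P: "\<And>I J. P I J \<in> carrier_mat n n"
    and k: "Suc k < N" and pq: "p < n" "q < n"
  shows "(\<Sum>K<N. ((if Suc k = K then 1\<^sub>m n else if Suc k = K + 1 then - \<Phi> else 0\<^sub>m n n) * P K J) $$ (p, q)) =
    (P (Suc k) J - \<Phi> * P k J) $$ (p, q)" (is "(\<Sum>K<N. (?A K * _) $$ _) = _")
proof -
  have "(?A K * P K J) $$ (p, q) =
      (if K = Suc k then P (Suc k) J $$ (p, q) else 0) +
      (if K = k then - ((\<Phi> * P k J) $$ (p, q)) else 0)" for K
  proof -
    have "(- \<Phi> * P k J) $$ (p, q) = - ((\<Phi> * P k J) $$ (p, q))"
      using \<Phi> pq carrier_matD[OF P[of k J]] uminus_mult_left_mat[of \<Phi> "P k J"]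
      by (simp del: index_mult_mat(1))
    then show ?thesis
      using pq by (simp add: left_mult_one_mat[OF P] left_mult_zero_mat[OF P] del: index_mult_mat(1))
  qed
  then show ?thesis
    using k pq \<Phi> carrier_matD[OF P]
    by (simp add: sum.distrib del: index_mult_mat(1))
qed

lemma transpose_F_injection_time_interpolation:
  assumes \<Phi>: "\<Phi> \<in> carrier_mat n n"
    and s: "\<And>j. j < b \<Longrightarrow> s j < N0" "\<And>j. j < b \<Longrightarrow> \<not> m dvd s j"
  shows "transpose_mat (selection_mat n N0 b s) * time_mat n N0 \<Phi> *
    ideal_interpolation n m N0 N1 \<Phi> = 0\<^sub>m (b * n) (N1 * n)"
proof -
  let ?P = "\<lambda>k j. if j * m \<le> k \<and> k < j * m + m then \<Phi> ^\<^sub>m (k - j * m) else 0\<^sub>m n n"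
  let ?A = "\<lambda>i j. if i = j then 1\<^sub>m n else if i = j + 1 then - \<Phi> else 0\<^sub>m n n"
  have P: "?P k j \<in> carrier_mat n n" and A: "?A k j \<in> carrier_mat n n" for k j
    using \<Phi> by auto
  have "transpose_mat (selection_mat n N0 b s) * time_mat n N0 \<Phi> =
      blocks_mat n b N0 (\<lambda>i j. ?A (s i) j)"
    unfolding time_mat_def by (rule transpose_selection_mult[OF A s(1)])
  also have "\<dots> * ideal_interpolation n m N0 N1 \<Phi> = blocks_mat n b N1 (\<lambda>_ _. 0\<^sub>m n n)"
    unfolding ideal_interpolation_def
  proof (rule blocks_mat_mult_eqI)
    fix I J p q assume *: "I < b" "J < N1" "p < n" "q < n"
    \<comment> \<open>Index \<open>0\<close> is a C-point because \<open>m dvd 0\<close>, so an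
      F-point has a predecessor.\<close>
    obtain k where k: "s I = Suc k"
      using s(2)[OF *(1)] by (cases "s I") auto
    have step: "?P (Suc k) J = \<Phi> * ?P k J"
      using s(2)[OF *(1)] k by (intro interpolation_block_step \<Phi>) simp
    show "(\<Sum>K<N0. (?A (s I) K * ?P K J) $$ (p, q)) = 0\<^sub>m n n $$ (p, q)"
      unfolding k using s(1)[OF *(1)] k * step \<Phi> P[of J k]
      by (subst time_mat_block_row_mult[OF \<Phi> P]) simp_all
  qed (use P A in auto)
  also have "\<dots> = 0\<^sub>m (b * n) (N1 * n)"
    by (rule eq_matI) (simp_all add: blocks_mat_index div_mod_less_mult)
  finally show ?thesis .
qed

section \<open>The injections as selections, and their one-sided inverses\<close>

lemma injection_restriction_eq:
  "injection_restriction n m N0 N1 = transpose_mat (selection_mat n N0 N1 (\<lambda>j. j * m))"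
  by (simp add: injection_restriction_def transpose_selection_mat)

lemma F_injection_eq:
  "F_injection n m N0 = selection_mat n N0 (length (F_points m N0)) ((!) (F_points m N0))"
  by (simp add: F_injection_def selection_mat_def)

text \<open>Serves twice: for the triangularity of \<open>S^T A S\<close> and for the injectivity of
  the F-point selection.\<close>

lemma strict_mono_on_F_points:
  "strict_mono_on {..<length (F_points m N0)} ((!) (F_points m N0))"
proof -
  have "sorted_wrt (<) (F_points m N0)"
    unfolding F_points_def by (simp add: sorted_wrt_filter)
  then show ?thesis
    by (auto simp: strict_mono_on_def sorted_wrt_iff_nth_less)
qed

text \<open>The only C-point in the interval of column \<open>j\<close> is its left end
  \<open>j * m\<close>, where the block is the power with exponent \<open>0\<close>.\<close>

lemma injection_interpolation:
  assumes \<Phi>: "\<Phi> \<in> carrier_mat n n" and m: "m \<ge> 1" and le: "\<And>j. j < N1 \<Longrightarrow> j * m < N0"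
  shows "injection_restriction n m N0 N1 * ideal_interpolation n m N0 N1 \<Phi> = 1\<^sub>m (N1 * n)"
proof -
  have iff: "j * m \<le> i * m \<and> i * m < j * m + m \<longleftrightarrow> i = j" for i j
  proof -
    have "i * m < j * m + m \<longleftrightarrow> i < Suc j"
      using m mult_less_cancel2[of i m "Suc j"] by (simp add: add.commute)
    then show ?thesis using m by auto
  qed
  have "(if j * m \<le> i * m \<and> i * m < j * m + m then \<Phi> ^\<^sub>m (i * m - j * m) else 0\<^sub>m n n) =
      (if i = j then 1\<^sub>m n else 0\<^sub>m n n)" for i j
    unfolding iff using \<Phi> by simp
  then show ?thesis
    unfolding injection_restriction_eq ideal_interpolation_def blocks_mat_one[symmetric]
    by (subst transpose_selection_mult) (use \<Phi> le in auto)
qed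

text \<open>For \<open>j >= 1\<close> the only C-point in the support of row \<open>j\<close> is its
  right end \<open>j * m\<close>, where the exponent is \<open>0\<close>; row \<open>0\<close> sees
  only column \<open>0\<close>.\<close>

lemma restriction_injection:
  assumes \<Phi>: "\<Phi> \<in> carrier_mat n n" and m: "m \<ge> 1" and le: "\<And>j. j < N1 \<Longrightarrow> j * m < N0"
  shows "ideal_restriction n m N0 N1 \<Phi> * transpose_mat (injection_restriction n m N0 N1) =
    1\<^sub>m (N1 * n)"
proof -
  have iff: "(j - 1) * m + 1 \<le> i * m \<and> i * m \<le> (j - 1) * m + m \<longleftrightarrow> i = j" if "j \<noteq> 0" for i j
  proof -
    from that obtain l where "j = Suc l" by (cases j) auto
    moreover have "i * m \<le> l * m + m \<longleftrightarrow> i \<le> Suc l"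
      using m mult_le_cancel2[of i m "Suc l"] by (simp add: add.commute)
    moreover have "l * m + 1 \<le> i * m \<longleftrightarrow> l < i"
      using m mult_less_cancel2[of l m i] by (simp add: Suc_le_eq)
    ultimately show ?thesis by auto
  qed
  have "(if j = 0 then if i * m = 0 then 1\<^sub>m n else 0\<^sub>m n n
      else if (j - 1) * m + 1 \<le> i * m \<and> i * m \<le> (j - 1) * m + m
        then \<Phi> ^\<^sub>m (m - (i * m - (j - 1) * m)) else 0\<^sub>m n n) =
      (if j = i then 1\<^sub>m n else 0\<^sub>m n n)" for i j
  proof (cases j)
    case 0
    then show ?thesis using m by auto
  next
    case (Suc l)
    then have "m - (j * m - (j - 1) * m) = 0" by simp
    moreover have "j \<noteq> 0" using Suc by simp
    ultimately show ?thesis using \<Phi> unfolding iff[OF \<open>j \<noteq> 0\<close>] by auto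
  qed
  then show ?thesis
    unfolding injection_restriction_eq ideal_restriction_def transpose_transpose
      blocks_mat_one[symmetric]
    by (subst mult_selection) (use \<Phi> le in auto)
qed

section \<open>Relaxation on the range of interpolation\<close>

lemma
  assumes \<Phi>: "\<Phi> \<in> carrier_mat n n" and m: "m \<ge> 1"
    and N0: "N0 = (N1 - 1) * m + 1" and N1: "N1 \<ge> 1"
  defines "A \<equiv> time_mat n N0 \<Phi>" and "P \<equiv> ideal_interpolation n m N0 N1 \<Phi>"
    and "J \<equiv> injection_restriction n m N0 N1"
  shows F_relax_eq: "F_relax n m N0 \<Phi> = P * J"
    and time_interpolation_eq: "transpose_mat J * (J * (A * P)) = A * P"
proof -
  define F where "F = F_relax n m N0 \<Phi>"
  let ?pts = "F_points m N0" and ?f = "length (F_points m N0)"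
  let ?N = "N0 * n" and ?M = "N1 * n" and ?K = "?f * n"
  define S where "S = F_injection n m N0"
  define X where "X = transpose_mat S * A * S"
  have le: "j * m < N0" if "j < N1" for j
  proof -
    have "j * m \<le> (N1 - 1) * m" using that by (intro mult_le_mono1) simp
    then show ?thesis using N0 by linarith
  qed
  have pts: "?pts ! q < N0" "\<not> m dvd ?pts ! q" if "q < ?f" for q
    using nth_mem[OF that] by (auto simp: F_points_def)
  have A: "A \<in> carrier_mat ?N ?N" and P: "P \<in> carrier_mat ?N ?M"
    and J: "J \<in> carrier_mat ?M ?N" and S: "S \<in> carrier_mat ?N ?K"
    by (simp_all add: A_def P_def J_def S_def time_mat_def ideal_interpolation_def
        injection_restriction_def F_injection_def)
  have JT: "transpose_mat J \<in> carrier_mat ?N ?M" and ST: "transpose_mat S \<in> carrier_mat ?K ?N"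
    using J S by simp_all
  have X: "X \<in> carrier_mat ?K ?K"
    using A S ST by (simp add: X_def)
  have JP: "J * P = 1\<^sub>m ?M"
    unfolding J_def P_def by (rule injection_interpolation[OF \<Phi> m le])
  have "transpose_mat S * A * P = 0\<^sub>m ?K ?M"
    unfolding S_def A_def P_def F_injection_eq
    by (rule transpose_F_injection_time_interpolation[OF \<Phi>]) (use pts in auto)
  then have SAP: "transpose_mat S * (A * P) = 0\<^sub>m ?K ?M"
    using assoc_mult_mat[OF ST A P] by simp
  have complement: "S * transpose_mat S + transpose_mat J * J = 1\<^sub>m ?N"
  proof -
    have image: "(!) ?pts ` {..<?f} = {k. k < N0 \<and> \<not> m dvd k}"
    proof -
      have "(!) ?pts ` {..<?f} = set ?pts" by (auto simp: set_conv_nth)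
      then show ?thesis by (auto simp: F_points_def)
    qed
    \<comment> \<open>The last block index is \<open>(N1 - 1) * m\<close>, so each multiple of
      \<open>m\<close> below \<open>N0\<close> is one of the \<open>N1\<close> C-points.\<close>
    have "k \<in> (\<lambda>j. j * m) ` {..<N1}" if k: "k < N0" "m dvd k" for k
    proof -
      from k(2) obtain l where l: "k = l * m" by (auto simp: dvd_def mult.commute)
      then have "l * m \<le> (N1 - 1) * m" using k N0 by linarith
      then have "l \<le> N1 - 1" using m mult_le_cancel2[of l m "N1 - 1"] by linarith
      then show ?thesis using l N1 by auto
    qed
    then show ?thesis
      unfolding S_def J_def F_injection_eq injection_restriction_eq transpose_transpose
      by (intro selection_complement strict_mono_on_imp_inj_on[OF strict_mono_on_F_points])
        (use m in \<open>auto simp: image inj_on_def\<close>)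
  qed
  have "det X = 1"
  proof -
    \<comment> \<open>\<open>X\<close> is the principal block submatrix of \<open>A\<close> at the
      F-points.\<close>
    have "X = blocks_mat n ?f ?f (\<lambda>i j. if ?pts ! i = ?pts ! j then 1\<^sub>m n
      else if ?pts ! i = ?pts ! j + 1 then - \<Phi> else 0\<^sub>m n n)"
      unfolding X_def A_def S_def F_injection_eq time_mat_def
      by (subst transpose_selection_mult) (use \<Phi> pts in \<open>auto simp: mult_selection\<close>)
    then show ?thesis
      using det_principal_time_mat[OF strict_mono_on_F_points \<Phi>] by simp
  qed
  then have inv: "inv_mat X \<in> carrier_mat ?K ?K" and invX: "inv_mat X * X = 1\<^sub>m ?K"
    using inv_mat_left_inverse[OF X] by simp_all
  define Q where "Q = S * inv_mat X"
  have Q: "Q \<in> carrier_mat ?N ?K" using S inv by (simp add: Q_def)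
  have F_eq: "F = 1\<^sub>m ?N - Q * (transpose_mat S * A)"
    unfolding assoc_mult_mat[OF Q ST A, symmetric]
    by (simp add: F_def F_relax_def Let_def Q_def X_def S_def A_def)
  have F: "F \<in> carrier_mat ?N ?N"
    unfolding F_eq by (rule minus_carrier_mat[OF mult_carrier_mat[OF Q mult_carrier_mat[OF ST A]]])
  \<comment> \<open>The column count \<open>c\<close> is free, so that the formula applies to both
    \<open>S\<close> and \<open>P\<close>.\<close>
  have F_mult: "F * Y = Y - Q * (transpose_mat S * A * Y)" if Y: "Y \<in> carrier_mat ?N c" for Y c
    unfolding F_eq using Q ST A Y
    by (simp add: minus_mult_distrib_mat[of _ ?N ?N _ _ c] assoc_mult_mat[of _ ?N ?K _ ?N _ c])
  have "Q * X = S"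
    unfolding Q_def using S inv X by (simp add: assoc_mult_mat[of _ ?N ?K _ ?K _ ?K] invX)
  \<comment> \<open>\<open>F\<close> annihilates F-point errors:
    \<open>F S = S - Q X = 0\<close>.\<close>
  then have FS: "F * S = 0\<^sub>m ?N ?K"
    using F_mult[OF S] S by (simp add: X_def)
  have FP: "F * P = P"
    using F_mult[OF P] P Q A ST SAP by (auto simp: right_mult_zero_mat)
  have FTJ: "F * transpose_mat J * J = F"
  proof -
    have "F = F * (S * transpose_mat S + transpose_mat J * J)"
      using F complement by simp
    also have "\<dots> = F * (S * transpose_mat S) + F * (transpose_mat J * J)"
      using F S ST J JT by (intro mult_add_distrib_mat) auto
    also have "\<dots> = F * S * transpose_mat S + F * transpose_mat J * J"
      unfolding assoc_mult_mat[OF F S ST] assoc_mult_mat[OF F JT J] ..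
    finally show ?thesis
      unfolding FS using F J JT ST by simp
  qed
  show "transpose_mat J * (J * (A * P)) = A * P"
  proof -
    \<comment> \<open>The F-point part of \<open>A P\<close> vanishes, so \<open>A P\<close> is
      supported on the C-points.\<close>
    have "A * P = (S * transpose_mat S + transpose_mat J * J) * (A * P)"
      using A P complement by simp
    also have "\<dots> = S * (transpose_mat S * (A * P)) + transpose_mat J * (J * (A * P))"
      using A P S ST J JT
      by (subst add_mult_distrib_mat[of _ ?N ?N])
        (auto simp: assoc_mult_mat[of _ ?N ?K _ ?N _ ?M] assoc_mult_mat[of _ ?N ?M _ ?N _ ?M])
    finally show ?thesis using SAP A P S J JT by simp
  qed
  have "P = F * transpose_mat J * J * P" by (simp add: FTJ FP)
  also have "\<dots> = F * transpose_mat J"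
    using assoc_mult_mat[OF mult_carrier_mat[OF F JT] J P] F JT by (simp only: JP) simp
  finally show "F_relax n m N0 \<Phi> = P * J"
    using FTJ by (simp flip: F_def)
qed

section \<open>Coarse-grid correction after rFCF-relaxation\<close>

theorem lemma3p1:
  fixes Nx m0 N0 N1 r :: nat
    and \<Phi>0 \<Phi>1 A0 A1 R0 P0 RI0 :: "real mat"
  assumes "Nx \<ge> 1" and "m0 \<ge> 1"
    and "m0 dvd N0 - 1" and "N1 = (N0 - 1) div m0 + 1" and "N1 \<ge> 2"
    and "\<Phi>0 \<in> carrier_mat Nx Nx" and "\<Phi>1 \<in> carrier_mat Nx Nx"
  defines "A0 \<equiv> time_mat Nx N0 \<Phi>0" and "A1 \<equiv> time_mat Nx N1 \<Phi>1"
    and "R0 \<equiv> ideal_restriction Nx m0 N0 N1 \<Phi>0"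
    and "P0 \<equiv> ideal_interpolation Nx m0 N0 N1 \<Phi>0"
    and "RI0 \<equiv> injection_restriction Nx m0 N0 N1"
  shows "mgrit_error r Nx m0 N0 N1 \<Phi>0 \<Phi>1 =
    (1\<^sub>m (N0 * Nx) - P0 * inv_mat A1 * R0 * A0) * P0 *
      (1\<^sub>m (N1 * Nx) - R0 * A0 * P0) ^\<^sub>m r * RI0"
proof -
  let ?N = "N0 * Nx" and ?M = "N1 * Nx"
  let ?F = "F_relax Nx m0 N0 \<Phi>0" and ?C = "C_relax Nx m0 N0 N1 \<Phi>0"
  let ?T = "transpose_mat RI0"
  \<comment> \<open>\<open>N0 - 1\<close> is truncated subtraction: \<open>N0 = 0\<close> would give
    \<open>N1 = 1\<close>, against \<open>N1 >= 2\<close>.\<close>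
  have "N0 > 0" using assms(4,5) by (cases N0) auto
  then have N0: "N0 = (N1 - 1) * m0 + 1" using assms(3,4) by simp
  have le: "j * m0 < N0" if "j < N1" for j
  proof -
    have "j * m0 \<le> (N1 - 1) * m0" using that by (intro mult_le_mono1) simp
    then show ?thesis using N0 by linarith
  qed
  have N1: "N1 \<ge> 1" using assms(5) by simp
  note F_eq = F_relax_eq[OF assms(6,2) N0 N1, folded P0_def RI0_def]
  note AP_eq = time_interpolation_eq[OF assms(6,2) N0 N1, folded A0_def P0_def RI0_def]
  have A: "A0 \<in> carrier_mat ?N ?N" and P: "P0 \<in> carrier_mat ?N ?M"
    and J: "RI0 \<in> carrier_mat ?M ?N" and R: "R0 \<in> carrier_mat ?M ?N"
    by (simp_all add: A0_def P0_def RI0_def R0_def time_mat_def ideal_interpolation_def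
        injection_restriction_def ideal_restriction_def)
  have T: "?T \<in> carrier_mat ?N ?M" using J by simp
  have JP: "RI0 * P0 = 1\<^sub>m ?M"
    unfolding RI0_def P0_def by (rule injection_interpolation[OF assms(6,2) le])
  have RT: "R0 * ?T = 1\<^sub>m ?M"
    unfolding R0_def RI0_def by (rule restriction_injection[OF assms(6,2) le])
  have AP: "A0 * P0 \<in> carrier_mat ?N ?M" using A P by simp
  have JAP: "RI0 * (A0 * P0) \<in> carrier_mat ?M ?M" using J AP by simp
  have "R0 * A0 * P0 = R0 * (?T * (RI0 * (A0 * P0)))"
    unfolding AP_eq by (rule assoc_mult_mat[OF R A P])
  also have "\<dots> = RI0 * (A0 * P0)"
    unfolding assoc_mult_mat[OF R T JAP, symmetric] RT by (rule left_mult_one_mat[OF JAP])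
  finally have K: "R0 * A0 * P0 = RI0 * (A0 * P0)" .
  define D where "D = 1\<^sub>m ?M - R0 * A0 * P0"
  have D: "D \<in> carrier_mat ?M ?M"
    unfolding D_def K by (rule minus_carrier_mat[OF JAP])
  have C: "?C \<in> carrier_mat ?N ?N"
    unfolding C_relax_def Let_def RI0_def[symmetric] A0_def[symmetric] transpose_transpose
    by (rule minus_carrier_mat[OF mult_carrier_mat[OF mult_carrier_mat[OF T J] A]])
  have F: "?F \<in> carrier_mat ?N ?N"
    unfolding F_eq using P J by simp
  \<comment> \<open>On the range of \<open>P0\<close> the projector \<open>T J\<close> in the
    C-relaxation has no effect, as \<open>A0 * P0\<close> is already supported on the
    C-points.\<close>
  have CP: "?C * P0 = P0 - A0 * P0"
  proof -
    have "?C * P0 = P0 - ?T * RI0 * A0 * P0"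
      using A J T P
      by (simp add: C_relax_def Let_def minus_mult_distrib_mat[of _ ?N ?N _ _ ?M]
          flip: RI0_def A0_def)
    also have "?T * RI0 * A0 * P0 = ?T * (RI0 * (A0 * P0))"
      using A J T P AP
      by (simp add: assoc_mult_mat[of _ ?N ?N _ ?N _ ?M] assoc_mult_mat[of _ ?N ?M _ ?N _ ?M])
    finally show ?thesis by (simp add: AP_eq)
  qed
  have "?F * ?C * P0 = ?F * (P0 - A0 * P0)"
    using assoc_mult_mat[OF F C P] CP by simp
  also have "\<dots> = P0 * (RI0 * (P0 - A0 * P0))"
    unfolding F_eq using A P AP by (intro assoc_mult_mat[OF P J]) auto
  also have "RI0 * (P0 - A0 * P0) = D"
    unfolding D_def K using mult_minus_distrib_mat[OF J P AP] JP by simp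
  finally have "(?F * ?C) ^\<^sub>m r * P0 = P0 * D ^\<^sub>m r"
    using F C P D by (intro pow_mat_intertwine) auto
  moreover have FC: "(?F * ?C) ^\<^sub>m r \<in> carrier_mat ?N ?N"
    using F C by simp
  ultimately have relax: "rFCF_relax r Nx m0 N0 N1 \<Phi>0 = P0 * D ^\<^sub>m r * RI0"
    unfolding rFCF_relax_def using assoc_mult_mat[OF FC P J] by (simp flip: F_eq)
  define E where "E = 1\<^sub>m ?N - P0 * inv_mat A1 * R0 * A0"
  \<comment> \<open>The dimensions come from the outer factors \<open>P0\<close> and
    \<open>A0\<close>; \<open>inv_mat A1\<close> is carried along as an opaque factor.\<close>
  have E: "E \<in> carrier_mat ?N ?N"
    unfolding E_def using A P by (intro carrier_matI) auto
  have DR: "D ^\<^sub>m r \<in> carrier_mat ?M ?M" using D by simp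
  have "mgrit_error r Nx m0 N0 N1 \<Phi>0 \<Phi>1 = E * (P0 * D ^\<^sub>m r * RI0)"
    unfolding mgrit_error_def relax coarse_correction_def E_def A0_def A1_def P0_def R0_def ..
  also have "\<dots> = E * P0 * D ^\<^sub>m r * RI0"
    using E P DR J
    by (simp add: assoc_mult_mat[of _ ?N ?M _ ?M _ ?N] assoc_mult_mat[of _ ?N ?N _ ?M _ ?N]
        assoc_mult_mat[of _ ?N ?N _ ?M _ ?M])
  finally show ?thesis unfolding E_def D_def .
qed

end
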